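(* Let $k\ge 1$, $n\geq 1$, and let $\boldsymbol{\lambda}=(\lambda^{(0)},\dots,\lambda^{(k-1)})$ and $\boldsymbol{\rho}=(\rho^{(0)},\dots,\rho^{(k-1)})$ be colored partitions of $n$. Fix a color $s\in\{0,\dots,k-1\}$ and a part $\rho^{(s)}_m$ of $\rho^{(s)}=(\rho^{(s)}_1,\dots,\rho^{(s)}_m,\dots,\rho^{(s)}_{l(s)})$. Then the value of the irreducible character $\chi^{\boldsymbol{\lambda}}$ of $C_k\wr S_n$ at the class $\boldsymbol{\rho}$ is $$\chi^{\boldsymbol{\lambda}}_{\boldsymbol{\rho}}=\sum_{j=0}^{k-1}\sum_{\boldsymbol{\xi_j}}(-1)^{\mathrm{ht}(\boldsymbol{\xi_j})}\,\omega^{-sj}\,\chi^{\boldsymbol{\lambda}\setminus\boldsymbol{\xi_j}}_{\boldsymbol{\rho}\setminus\rho^{(s)}_m},$$ where, for each $j$, $\boldsymbol{\xi_j}$ runs through all colored $\rho^{(s)}_m$-rim hooks contained in $\boldsymbol{\lambda}$ that are supported at the $j$-th constituent.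
   Context: Fix $k\ge1$, $\omega=e^{2\pi i/k}$ and $I=\{0,1,\dots,k-1\}$. A colored partition of $n$ is a $k$-tuple $\boldsymbol{\lambda}=(\lambda^{(0)},\dots,\lambda^{(k-1)})$ of (possibly empty) partitions, called its constituents, with $\|\boldsymbol{\lambda}\|=\sum_i|\lambda^{(i)}|=n$. Let $C_k=\langle c\rangle$ be cyclic of order $k$ and $C_k\wr S_n=C_k^n\rtimes S_n$, with product $(g;\sigma)(h;\tau)=(g\sigma(h);\sigma\tau)$. The conjugacy class of $(g;\sigma)$ is of type $\boldsymbol{\rho}$, where the parts of $\rho^{(i)}$ are the lengths of those cycles of $\sigma$ whose cycle product is $c^i$. Irreducible characters $\chi^{\boldsymbol{\lambda}}$ are indexed by colored partitions of $n$, and $\chi^{\boldsymbol{\lambda}}_{\boldsymbol{\rho}}$ is the value at the class of type $\boldsymbol{\rho}$, with the following normalization. Let $V$ be the complex polynomial algebra in variables $a_{-jr}$ ($j\in I$, $r\ge1$), with the bilinear form for which the monomials $\prod_{j}\prod_t a_{-j\mu^{(j)}_t}$ ($\boldsymbol\mu$ a colored partition) are orthogonal with squared norm $\prod_j z_{\mu^{(j)}}$, where $z_\mu=\prod_i i^{m_i}m_i!$ for $\mu=(1^{m_1}2^{m_2}\cdots)$. Let $s_{j\lambda}$ be the Schur function $s_\lambda$ written as a polynomial in power sums $p_r$, with $p_r$ replaced by $a_{-jr}$; put $s_{\boldsymbol{\lambda}}=\prod_j s_{j\lambda^{(j)}}$, $\widetilde a_{-ir}=\sum_{j\in I}\omega^{-ij}a_{-jr}$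 and $\widetilde a_{-\boldsymbol{\rho}}=\prod_i\prod_t\widetilde a_{-i\rho^{(i)}_t}$. Then (a known theorem) $\chi^{\boldsymbol{\lambda}}_{\boldsymbol{\rho}}=\langle s_{\boldsymbol{\lambda}},\widetilde a_{-\boldsymbol{\rho}}\rangle$, which may be taken as the definition. In particular, for $n=1$ the character with the box in color $j$ takes the value $\omega^{-ij}$ at $c^i$; for $n=0$ the value is $1$. For partitions $\mu\subset\lambda$, the skew diagram $\lambda-\mu$ is a rim hook if it is nonempty, connected and contains no $2\times2$ block of boxes; it is an $m$-rim hook if it has $m$ boxes, and its height $\mathrm{ht}$ is the number of rows it occupies minus one. A colored $m$-rim hook $\boldsymbol{\xi}$ contained in $\boldsymbol{\lambda}$ and supported at the $j$-th constituent is a difference $\boldsymbol{\lambda}-\boldsymbol{\mu}$ with $\mu^{(i)}=\lambda^{(i)}$ for $i\ne j$ and $\lambda^{(j)}-\mu^{(j)}$ an $m$-rim hook; $\boldsymbol{\lambda}\setminus\boldsymbol{\xi}:=\boldsymbol{\mu}$, and $\mathrm{ht}(\boldsymbol{\xi}):=\mathrm{ht}(\lambda^{(j)}-\mu^{(j)})$. The colored partition $\boldsymbol{\rho}\setminus\rho^{(s)}_m$ is obtained by deleting the part $\rho^{(s)}_m$ from $\rho^{(s)}$. *)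

theory Defs
  imports
    Complex_Main
    "HOL-Library.Poly_Mapping"
    "Jordan_Normal_Form.Determinant"
begin

section \<open>Partitions and colored partitions\<close>

definition is_partition :: "nat list \<Rightarrow> bool" where
  "is_partition mu \<longleftrightarrow> sorted_wrt (\<ge>) mu \<and> (\<forall>r\<in>set mu. 0 < r)"

definition partitions_of :: "nat \<Rightarrow> nat list set" where
  "partitions_of n = {mu. is_partition mu \<and> sum_list mu = n}"

text \<open>The constituent of color \<^term>\<open>i\<close> is \<^term>\<open>L ! i\<close>, for \<^term>\<open>i < k\<close>.\<close>

definition is_colored_partition :: "nat \<Rightarrow> nat \<Rightarrow> nat list list \<Rightarrow> bool" where
  "is_colored_partition k n L \<longleftrightarrow>
     length L = k \<and> (\<forall>i<k. is_partition (L ! i)) \<and> (\<Sum>i<k. sum_list (L ! i)) = n"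

definition delete_nth :: "nat \<Rightarrow> 'a list \<Rightarrow> 'a list" where
  "delete_nth m xs = take m xs @ drop (Suc m) xs"

text \<open>Deletes the part with index \<^term>\<open>m\<close> (counted from 0) of the constituent of color \<^term>\<open>s\<close>.\<close>

definition remove_part :: "nat list list \<Rightarrow> nat \<Rightarrow> nat \<Rightarrow> nat list list" where
  "remove_part R s m = R[s := delete_nth m (R ! s)]"

section \<open>Rim hooks\<close>

text \<open>A box is a pair (row, column), both counted from 0.\<close>

definition diagram :: "nat list \<Rightarrow> (nat \<times> nat) set" where
  "diagram mu = {(r, c). r < length mu \<and> c < mu ! r}"

definition box_adjacent :: "nat \<times> nat \<Rightarrow> nat \<times> nat \<Rightarrow> bool" where
  "box_adjacent b b' \<longleftrightarrow>
     (fst b = fst b' \<and> (snd b = Suc (snd b') \<or> snd b' = Suc (snd b))) \<or>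
     (snd b = snd b' \<and> (fst b = Suc (fst b') \<or> fst b' = Suc (fst b)))"

definition connected_boxes :: "(nat \<times> nat) set \<Rightarrow> bool" where
  "connected_boxes D \<longleftrightarrow>
     (\<forall>b\<in>D. \<forall>b'\<in>D. (b, b') \<in> {(x, y). x \<in> D \<and> y \<in> D \<and> box_adjacent x y}\<^sup>*)"

definition is_rim_hook :: "(nat \<times> nat) set \<Rightarrow> bool" where
  "is_rim_hook D \<longleftrightarrow> D \<noteq> {} \<and> connected_boxes D \<and>
     (\<nexists>r c. {(r, c), (r, Suc c), (Suc r, c), (Suc r, Suc c)} \<subseteq> D)"

definition ht :: "(nat \<times> nat) set \<Rightarrow> nat" where
  "ht D = card (fst ` D) - 1"

definition colored_diff :: "nat list list \<Rightarrow> nat list list \<Rightarrow> nat \<Rightarrow> (nat \<times> nat) set" where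
  "colored_diff L M j = diagram (L ! j) - diagram (M ! j)"

text \<open>A colored hook contained in \<^term>\<open>L\<close> and supported at the constituent \<^term>\<open>j\<close> is encoded
  by the colored partition \<^term>\<open>M\<close> that its removal leaves; the hook itself is recovered as
  \<^term>\<open>colored_diff L M j\<close>. Since partitions are lists without zero parts, this encoding is
  one-to-one.\<close>

definition rim_hook_removals :: "nat \<Rightarrow> nat list list \<Rightarrow> nat \<Rightarrow> nat list list set" where
  "rim_hook_removals m L j =
     {M. length M = length L \<and> (\<forall>i<length L. i \<noteq> j \<longrightarrow> M ! i = L ! i) \<and>
         is_partition (M ! j) \<and> diagram (M ! j) \<subseteq> diagram (L ! j) \<and>
         is_rim_hook (colored_diff L M j) \<and> card (colored_diff L M j) = m}"

section \<open>The polynomial algebra and its bilinear form\<close>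

text \<open>Finitely supported functions from exponents to coefficients, with convolution as product.
  The pair \<^term>\<open>(j, r)\<close> indexes the variable \<open>a\<^bsub>-jr\<^esub>\<close>; only the indices with \<^term>\<open>j < k\<close> and
  \<^term>\<open>1 \<le> r\<close> are used.\<close>

type_synonym exponent = "(nat \<times> nat) \<Rightarrow>\<^sub>0 nat"
type_synonym fock = "exponent \<Rightarrow>\<^sub>0 complex"

definition scalar :: "complex \<Rightarrow> fock" where
  "scalar x = Poly_Mapping.single 0 x"

definition avar :: "nat \<Rightarrow> nat \<Rightarrow> fock" where
  "avar j r = Poly_Mapping.single (Poly_Mapping.single (j, r) 1) 1"

definition z_part :: "nat list \<Rightarrow> nat" where
  "z_part mu = (\<Prod>r\<in>set mu. r ^ count_list mu r * fact (count_list mu r))"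

text \<open>If \<^term>\<open>e\<close> is the exponent of the monomial of a colored partition, then
  \<^term>\<open>Poly_Mapping.lookup e (j, r)\<close> is the multiplicity of the part \<^term>\<open>r\<close> in the constituent \<^term>\<open>j\<close>,
  so this is the product of the numbers \<^const>\<open>z_part\<close> of the constituents.\<close>

definition z_exponent :: "exponent \<Rightarrow> nat" where
  "z_exponent e = (\<Prod>(j, r)\<in>Poly_Mapping.keys e. r ^ Poly_Mapping.lookup e (j, r) * fact (Poly_Mapping.lookup e (j, r)))"

text \<open>Bilinear, not sesquilinear: there is no complex conjugation.\<close>

definition form :: "fock \<Rightarrow> fock \<Rightarrow> complex" where
  "form F G = (\<Sum>e\<in>Poly_Mapping.keys F. Poly_Mapping.lookup F e * Poly_Mapping.lookup G e * of_nat (z_exponent e))"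

section \<open>Schur functions as polynomials in the power sums\<close>

text \<open>The argument \<^term>\<open>p\<close> supplies the elements that are put in place of the power sums.
  \<open>h\<^sub>n = (\<Sum>\<mu>\<turnstile>n. p\<^sub>\<mu> / z\<^sub>\<mu>)\<close> is the complete homogeneous symmetric function, which vanishes for
  negative index, and the Schur function is the determinant of Jacobi and Trudi
  \<open>s\<^sub>\<lambda> = det (h\<^bsub>\<lambda>\<^sub>i - i + j\<^esub>)\<close>, equal to 1 for the empty partition.\<close>

definition hom_sym :: "(nat \<Rightarrow> fock) \<Rightarrow> int \<Rightarrow> fock" where
  "hom_sym p d = (if d < 0 then 0
     else (\<Sum>mu\<in>partitions_of (nat d). scalar (1 / of_nat (z_part mu)) * prod_list (map p mu)))"

definition schur :: "(nat \<Rightarrow> fock) \<Rightarrow> nat list \<Rightarrow> fock" where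
  "schur p lam = Determinant.det (mat (length lam) (length lam)
     (\<lambda>(i, j). hom_sym p (int (lam ! i) - int i + int j)))"

definition colored_schur :: "nat list list \<Rightarrow> fock" where
  "colored_schur L = (\<Prod>j<length L. schur (avar j) (L ! j))"

section \<open>Characters of the wreath product\<close>

definition omega :: "nat \<Rightarrow> complex" where
  "omega k = exp (2 * of_real pi * \<i> / of_nat k)"

definition avar_tilde :: "nat \<Rightarrow> nat \<Rightarrow> nat \<Rightarrow> fock" where
  "avar_tilde k i r = (\<Sum>j<k. scalar (omega k powi (- int (i * j))) * avar j r)"

definition power_tilde :: "nat \<Rightarrow> nat list list \<Rightarrow> fock" where
  "power_tilde k R = (\<Prod>i<k. prod_list (map (avar_tilde k i) (R ! i)))"

text \<open>The value of the irreducible character of the wreath product of a cyclic group of order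
  \<^term>\<open>k\<close> with a symmetric group that is indexed by \<^term>\<open>L\<close>, at the class of type \<^term>\<open>R\<close>. It is
  defined by the characteristic map, the two arguments being colored partitions of the same number
  with \<^term>\<open>k\<close> constituents.\<close>

definition wreath_char :: "nat \<Rightarrow> nat list list \<Rightarrow> nat list list \<Rightarrow> complex" where
  "wreath_char k L R = form (colored_schur L) (power_tilde k R)"

end

theory Submission
  imports Defs
begin

text \<open>With respect to the form, multiplication by \<open>a\<^bsub>-jr\<^esub>\<close> is adjoint to the derivation
  \<open>D\<^bsub>jr\<^esub> = r \<partial>/\<partial>a\<^bsub>-jr\<^esub>\<close>. Splitting off the factor of the power sum product that belongs to the
  chosen part of length \<open>r\<close> therefore turns the character value into a combination of the
  \<open>D\<^bsub>jr\<^esub> s\<^sub>\<lambda>\<close> with coefficients \<open>\<omega>\<^bsup>-sj\<^esup>\<close>, and \<open>D\<^bsub>jr\<^esub>\<close> acts on the Schur function of color \<open>j\<close> only.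
  Since \<open>D\<^bsub>jr\<^esub> h\<^sub>d = h\<^bsub>d-r\<^esub>\<close>, the operator sends the Jacobi-Trudi determinant with row
  parameters \<open>\<beta>\<^sub>i = \<lambda>\<^sub>i - i\<close> to the sum over \<open>i\<close> of the determinants with \<open>\<beta>\<^sub>i\<close> replaced by
  \<open>\<beta>\<^sub>i - r\<close>. Such a determinant vanishes if the new value is already present or so small that
  the row is zero. Otherwise moving row \<open>i\<close> down to its place \<open>i'\<close> costs the sign \<open>(-1)\<^bsup>i'-i\<^esup>\<close> and
  yields the Schur function of the partition left by removing a rim hook that occupies the rows
  \<open>i, \<dots>, i'\<close>; every rim hook with \<open>r\<close> boxes arises in this way exactly once.\<close>

section \<open>The adjoint of multiplication by a variable\<close>

text \<open>Updating at a key outside the support adds a single term. Identities additive in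
  \<open>f\<close> therefore need checking on monomials only.\<close>

lemma poly_mapping_single_induct [case_names single add]:
  assumes "\<And>a c. P (Poly_Mapping.single a c)"
    and "\<And>f g. P f \<Longrightarrow> P g \<Longrightarrow> P (f + g)"
  shows "P (f :: 'a \<Rightarrow>\<^sub>0 'b::comm_monoid_add)"
proof (induction f rule: update_induct)
  case const
  have "P (Poly_Mapping.single undefined 0)" by (rule assms(1))
  then show ?case by simp
next
  case (update f a b)
  have "Poly_Mapping.update a b f = f + Poly_Mapping.single a b"
    using update(1) by (intro poly_mapping_eqI)
      (auto simp: lookup_update lookup_add lookup_single in_keys_iff when_def)
  then show ?case using update assms by simp
qed

text \<open>\<open>skew (j, r)\<close> is the operator \<open>r \<partial>/\<partial>a\<^bsub>-jr\<^esub>\<close>, given by its effect on coefficients.\<close>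

lift_definition skew :: "nat \<times> nat \<Rightarrow> fock \<Rightarrow> fock" is
  "\<lambda>v F e. of_nat (snd v * Suc (Poly_Mapping.lookup e v)) * F (e + Poly_Mapping.single v 1)"
proof -
  fix v :: "nat \<times> nat" and F :: "exponent \<Rightarrow> complex"
  assume "finite {e. F e \<noteq> 0}"
  then have "finite ((\<lambda>e. e + Poly_Mapping.single v 1) -` {e. F e \<noteq> 0})"
    by (rule finite_vimageI) (simp add: inj_on_def)
  then show "finite {e. of_nat (snd v * Suc (Poly_Mapping.lookup e v))
      * F (e + Poly_Mapping.single v 1) \<noteq> 0}"
    by (rule rev_finite_subset) auto
qed

lemma skew_add [simp]: "skew v (F + G) = skew v F + skew v G"
  by (intro poly_mapping_eqI) (simp add: skew.rep_eq lookup_add algebra_simps)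

lemma skew_zero [simp]: "skew v 0 = 0"
  by (intro poly_mapping_eqI) (simp add: skew.rep_eq)

lemma skew_sum: "skew v (\<Sum>x\<in>A. f x) = (\<Sum>x\<in>A. skew v (f x))"
  by (induction A rule: infinite_finite_induct) auto

text \<open>Subtraction of exponents is truncated at 0, so it can be undone only if \<open>v\<close>
  occurs in \<open>e\<close>.\<close>

lemma minus_single_eq:
  fixes e :: exponent
  assumes "Poly_Mapping.lookup e v \<noteq> 0"
  shows "e - Poly_Mapping.single v 1 + Poly_Mapping.single v 1 = e"
  using assms by (intro poly_mapping_eqI) (auto simp: lookup_add lookup_minus lookup_single when_def)

text \<open>If \<open>v\<close> does not occur in \<open>e\<close>, the truncated exponent is not a
  shifted one, but then the coefficient is 0 and the formula persists.\<close>

lemma skew_single: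
  "skew v (Poly_Mapping.single e c) =
    Poly_Mapping.single (e - Poly_Mapping.single v 1) (of_nat (snd v * Poly_Mapping.lookup e v) * c)"
proof (intro poly_mapping_eqI)
  fix d
  show "Poly_Mapping.lookup (skew v (Poly_Mapping.single e c)) d = Poly_Mapping.lookup
    (Poly_Mapping.single (e - Poly_Mapping.single v 1) (of_nat (snd v * Poly_Mapping.lookup e v) * c)) d"
  proof (cases "Poly_Mapping.lookup e v = 0")
    case True
    then have "e \<noteq> d + Poly_Mapping.single v 1"
      by (auto simp: lookup_add)
    with True show ?thesis
      by (simp add: skew.rep_eq lookup_single)
  next
    case False
    note e = minus_single_eq[OF False]
    show ?thesis
    proof (cases "d = e - Poly_Mapping.single v 1")
      case True
      then have "e = d + Poly_Mapping.single v 1" using e by simp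
      then show ?thesis by (simp add: skew.rep_eq lookup_add)
    next
      case d: False
      then have "e \<noteq> d + Poly_Mapping.single v 1" by auto
      with d show ?thesis by (simp add: skew.rep_eq lookup_single)
    qed
  qed
qed

text \<open>Leibniz rule. Both sides are biadditive, so two monomials suffice: \<open>l\<close> and
  \<open>r\<close> bring both terms to the exponent \<open>a + b - ?s\<close>, and the
  multiplicities of \<open>v\<close> in \<open>a\<close> and \<open>b\<close> add up.\<close>

lemma skew_mult: "skew v (F * G) = skew v F * G + F * skew v G"
proof (induction F rule: poly_mapping_single_induct)
  case (single a c)
  show ?case
  proof (induction G rule: poly_mapping_single_induct)
    case (single b d)
    let ?n = "\<lambda>e. Poly_Mapping.lookup e v"
    let ?s = "Poly_Mapping.single v (1::nat)"
    have l: "Poly_Mapping.single (a - ?s + b) (of_nat (snd v * ?n a) * c * d)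
        = Poly_Mapping.single (a + b - ?s) (of_nat (snd v * ?n a) * (c * d))"
    proof (cases "?n a = 0")
      case False
      have "a - ?s + b + ?s = (a - ?s + ?s) + b" by (simp only: ac_simps)
      then have "a + b - ?s = a - ?s + b"
        unfolding minus_single_eq[OF False] by (metis add_diff_cancel_right')
      then show ?thesis by (simp only: mult.assoc)
    qed simp
    have r: "Poly_Mapping.single (a + (b - ?s)) (c * (of_nat (snd v * ?n b) * d))
        = Poly_Mapping.single (a + b - ?s) (of_nat (snd v * ?n b) * (c * d))"
    proof (cases "?n b = 0")
      case False
      have "a + (b - ?s) + ?s = a + (b - ?s + ?s)" by (simp only: ac_simps)
      then have "a + b - ?s = a + (b - ?s)"
        unfolding minus_single_eq[OF False] by (metis add_diff_cancel_right')
      then show ?thesis by (simp only: mult_ac)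
    qed simp
    show ?case
      unfolding skew_single mult_single l r single_add[symmetric]
      by (simp add: lookup_add distrib_left distrib_right)
  qed (simp add: distrib_left distrib_right ac_simps)
qed (simp add: distrib_left distrib_right ac_simps)

lemma skew_scalar [simp]: "skew v (scalar c) = 0"
  by (simp add: scalar_def skew_single)

lemma skew_one [simp]: "skew v 1 = 0"
  using skew_scalar[of v 1] by (simp add: scalar_def)

lemma skew_scalar_mult: "skew v (scalar c * F) = scalar c * skew v F"
  by (simp add: skew_mult)

lemma skew_avar: "skew v (avar j r) = (if v = (j, r) then scalar (of_nat r) else 0)"
  by (auto simp: avar_def skew_single scalar_def lookup_single)

lemma scalar_mult: "scalar a * scalar b = scalar (a * b)"
  by (simp add: scalar_def mult_single)

lemma scalar_add: "scalar (a + b) = scalar a + scalar b"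
  by (simp add: scalar_def single_add)

lemma scalar_sign: "scalar ((-1) ^ n) = (-1) ^ n"
  by (induction n) (simp_all add: scalar_mult[symmetric], simp_all add: scalar_def single_uminus)

lemma skew_sign_mult: "skew v ((-1) ^ n * F) = (-1) ^ n * skew v F"
  by (metis scalar_sign skew_scalar_mult)

text \<open>Keeping the product over all of \<open>A\<close> and altering one factor matches the
  expansion of a determinant with one altered row.\<close>

lemma skew_prod:
  assumes "finite A"
  shows "skew v (\<Prod>i\<in>A. f i) = (\<Sum>i\<in>A. \<Prod>j\<in>A. if j = i then skew v (f j) else f j)"
  using assms
proof (induction A rule: finite_induct)
  case (insert x A)
  have "skew v (\<Prod>i\<in>insert x A. f i) = skew v (f x) * (\<Prod>i\<in>A. f i) +
      f x * (\<Sum>i\<in>A. \<Prod>j\<in>A. if j = i then skew v (f j) else f j)"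
    using insert by (simp add: skew_mult)
  also have "\<dots> = (\<Sum>i\<in>insert x A. \<Prod>j\<in>insert x A. if j = i then skew v (f j) else f j)"
    using insert by (auto simp: sum_distrib_left intro!: arg_cong2[where f = "(+)"]
        arg_cong2[where f = "(*)"] prod.cong sum.cong)
  finally show ?case .
qed simp

section \<open>Bilinearity of the form and adjointness\<close>

lemma form_eq_sum:
  assumes "finite A" "Poly_Mapping.keys F \<subseteq> A"
  shows "form F G =
    (\<Sum>e\<in>A. Poly_Mapping.lookup F e * Poly_Mapping.lookup G e * of_nat (z_exponent e))"
  unfolding form_def using assms by (intro sum.mono_neutral_left) (auto simp: in_keys_iff)

lemma form_zero [simp]: "form 0 G = 0" "form F 0 = 0"
  by (simp_all add: form_def)

lemma form_add_left: "form (F + F') G = form F G + form F' G"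
proof -
  let ?A = "Poly_Mapping.keys F \<union> Poly_Mapping.keys F'"
  have "Poly_Mapping.keys (F + F') \<subseteq> ?A" by (rule keys_add)
  then show ?thesis
    by (simp add: form_eq_sum[of ?A] lookup_add sum.distrib algebra_simps)
qed

lemma form_add_right: "form F (G + G') = form F G + form F G'"
  by (simp add: form_def lookup_add sum.distrib algebra_simps)

lemma form_sum_left: "form (\<Sum>x\<in>A. f x) G = (\<Sum>x\<in>A. form (f x) G)"
  by (induction A rule: infinite_finite_induct) (auto simp: form_add_left)

lemma form_sum_right: "form F (\<Sum>x\<in>A. g x) = (\<Sum>x\<in>A. form F (g x))"
  by (induction A rule: infinite_finite_induct) (auto simp: form_add_right)

lemma form_single:
  "form (Poly_Mapping.single a c) (Poly_Mapping.single b d) =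
    (if a = b then c * d * of_nat (z_exponent a) else 0)"
  by (auto simp: form_eq_sum[of "{a}"] lookup_single when_def)

lemma form_scalar_left: "form (scalar c * F) G = c * form F G"
proof (induction F rule: poly_mapping_single_induct)
  case (single a d)
  show ?case
    by (induction G rule: poly_mapping_single_induct)
      (simp_all add: scalar_def mult_single form_single form_add_right algebra_simps)
qed (simp add: form_add_left algebra_simps)

lemma form_scalar_right: "form F (scalar c * G) = c * form F G"
proof (induction F rule: poly_mapping_single_induct)
  case (single a d)
  show ?case
    by (induction G rule: poly_mapping_single_induct)
      (simp_all add: scalar_def mult_single form_single form_add_right algebra_simps)
qed (simp add: form_add_left algebra_simps)

lemma z_exponent_eq_prod:
  assumes "finite A" "Poly_Mapping.keys e \<subseteq> A"
  shows "z_exponent e = (\<Prod>v\<in>A. snd v ^ Poly_Mapping.lookup e v * fact (Poly_Mapping.lookup e v))"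
  unfolding z_exponent_def case_prod_beta prod.collapse
  using assms by (intro prod.mono_neutral_left) (auto simp: in_keys_iff)

text \<open>Raising a multiplicity from \<open>q\<close> to \<open>q + 1\<close> multiplies
  \<open>r ^ q * fact q\<close> by \<open>r * (q + 1)\<close>, which is the coefficient in the
  definition of \<open>skew\<close>.\<close>

lemma z_exponent_add_single:
  "z_exponent (Poly_Mapping.single v 1 + e) = snd v * Suc (Poly_Mapping.lookup e v) * z_exponent e"
proof -
  let ?A = "insert v (Poly_Mapping.keys e)"
  let ?t = "\<lambda>e v. snd v ^ Poly_Mapping.lookup e v * fact (Poly_Mapping.lookup e v)"
  let ?e = "Poly_Mapping.single v 1 + e"
  have "Poly_Mapping.keys ?e \<subseteq> ?A"
    using keys_add[of "Poly_Mapping.single v (1::nat)" e] by auto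
  then have "z_exponent ?e = (\<Prod>v\<in>?A. ?t ?e v)"
    by (intro z_exponent_eq_prod) auto
  also have "\<dots> = ?t ?e v * (\<Prod>w\<in>?A - {v}. ?t ?e w)"
    by (intro prod.remove) auto
  also have "(\<Prod>w\<in>?A - {v}. ?t ?e w) = (\<Prod>w\<in>?A - {v}. ?t e w)"
    by (intro prod.cong) (auto simp: lookup_add lookup_single)
  also have "?t ?e v = snd v * Suc (Poly_Mapping.lookup e v) * ?t e v"
    by (simp add: lookup_add algebra_simps)
  also have "\<dots> * (\<Prod>w\<in>?A - {v}. ?t e w) =
      snd v * Suc (Poly_Mapping.lookup e v) * (?t e v * (\<Prod>w\<in>?A - {v}. ?t e w))"
    by (simp only: mult.assoc)
  also have "?t e v * (\<Prod>w\<in>?A - {v}. ?t e w) = (\<Prod>v\<in>?A. ?t e v)"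
    by (intro prod.remove[symmetric]) auto
  also have "\<dots> = z_exponent e"
    by (intro z_exponent_eq_prod[symmetric]) auto
  finally show ?thesis .
qed

text \<open>On monomials both sides vanish unless \<open>a = ?s + b\<close>; in that case the ratio
  of the squared norms equals the coefficient produced by \<open>skew_single\<close>.\<close>

lemma form_avar_mult: "form F (avar j r * G) = form (skew (j, r) F) G"
proof (induction F rule: poly_mapping_single_induct)
  case (single a c)
  show ?case
  proof (induction G rule: poly_mapping_single_induct)
    case (single b d)
    let ?s = "Poly_Mapping.single (j, r) (1::nat)"
    show ?case
    proof (cases "Poly_Mapping.lookup a (j, r) = 0")
      case True
      then have "a \<noteq> ?s + b" by (auto simp: lookup_add)
      with True show ?thesis
        by (simp add: avar_def mult_single skew_single form_single)
    next
      case False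
      note a = minus_single_eq[OF False]
      show ?thesis
      proof (cases "a - ?s = b")
        case True
        then have "a = ?s + b" using a by (simp add: add.commute)
        then show ?thesis using z_exponent_add_single[of "(j, r)" b]
          by (simp add: avar_def mult_single skew_single form_single lookup_add)
      next
        case b: False
        then have "a \<noteq> ?s + b" by auto
        with b show ?thesis
          by (simp add: avar_def mult_single skew_single form_single)
      qed
    qed
  qed (simp add: form_add_right algebra_simps)
qed (simp add: form_add_left)

section \<open>Jacobi-Trudi determinants\<close>

lemma prod_list_map_remove1:
  "x \<in> set xs \<Longrightarrow> f x * prod_list (map f (remove1 x xs)) = prod_list (map f xs)"
  for f :: "'a \<Rightarrow> 'b::comm_monoid_mult"
  by (induction xs) (auto simp: ac_simps)

text \<open>Every occurrence of \<open>r\<close> in \<open>mu\<close> contributes \<open>r\<close>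
  times the product without it, and these products agree by commutativity. If \<open>r\<close> does
  not occur, the count makes the right side 0.\<close>

lemma skew_power_sum:
  "skew (j, r) (prod_list (map (avar j) mu)) =
    scalar (of_nat (r * count_list mu r)) * prod_list (map (avar j) (remove1 r mu))"
proof (induction mu)
  case (Cons x mu)
  show ?case
  proof (cases "x = r")
    case True
    have "scalar (of_nat (r * count_list mu r)) *
        (avar j r * prod_list (map (avar j) (remove1 r mu))) =
        scalar (of_nat (r * count_list mu r)) * prod_list (map (avar j) mu)"
    proof (cases "r \<in> set mu")
      case True
      then show ?thesis by (simp only: prod_list_map_remove1)
    next
      case False
      then show ?thesis by (simp add: scalar_def)
    qed
    with True show ?thesis
      unfolding list.map prod_list.Cons skew_mult Cons.IH mult.left_commute[of "avar j x"]
      by (simp add: skew_avar scalar_add distrib_right)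
  next
    case False
    then show ?thesis
      unfolding list.map prod_list.Cons skew_mult Cons.IH mult.left_commute[of "avar j x"]
      by (simp add: skew_avar)
  qed
qed (simp add: scalar_def)

lemma skew_power_sum_other:
  "i \<noteq> j \<Longrightarrow> skew (j, r) (prod_list (map (avar i) mu)) = 0"
  by (induction mu) (auto simp: skew_mult skew_avar)

lemma z_part_eq_prod:
  assumes "finite A" "set mu \<subseteq> A"
  shows "z_part mu = (\<Prod>r\<in>A. r ^ count_list mu r * fact (count_list mu r))"
  unfolding z_part_def
  using assms by (intro prod.mono_neutral_left) (auto simp: count_list_0_iff)

text \<open>The factor split off from \<open>z_part\<close> is the one that
  \<open>skew_power_sum\<close> produces, so the two cancel in \<open>skew_hom_sym\<close>.\<close>

lemma z_part_remove1:
  assumes "r \<in> set mu"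
  shows "z_part mu = r * count_list mu r * z_part (remove1 r mu)"
proof -
  let ?t = "\<lambda>mu r. r ^ count_list mu r * fact (count_list mu r)"
  let ?A = "set mu - {r}"
  have s: "set (remove1 r mu) \<subseteq> set mu" by (rule set_remove1_subset)
  obtain c where c: "count_list mu r = Suc c"
    using assms by (metis count_list_0_iff not0_implies_Suc)
  have "z_part mu = ?t mu r * (\<Prod>x\<in>?A. ?t mu x)"
    unfolding z_part_def using assms by (intro prod.remove) auto
  also have "(\<Prod>x\<in>?A. ?t mu x) = (\<Prod>x\<in>?A. ?t (remove1 r mu) x)"
    by (intro prod.cong) (auto simp: count_list_remove1)
  also have "?t mu r = r * count_list mu r * ?t (remove1 r mu) r"
    by (simp add: count_list_remove1 c algebra_simps)
  finally have "z_part mu =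
      r * count_list mu r * (?t (remove1 r mu) r * (\<Prod>x\<in>?A. ?t (remove1 r mu) x))"
    by (simp only: mult.assoc)
  also have "?t (remove1 r mu) r * (\<Prod>x\<in>?A. ?t (remove1 r mu) x) = z_part (remove1 r mu)"
    unfolding z_part_eq_prod[OF finite_set s] using assms
    by (intro prod.remove[symmetric]) auto
  finally show ?thesis .
qed

lemma z_part_pos: "is_partition mu \<Longrightarrow> z_part mu > 0"
  by (auto simp: z_part_def is_partition_def intro!: prod_pos)

text \<open>A weakly decreasing list is the reverse of the sorted list of its entries.\<close>

lemma is_partition_unique:
  assumes "is_partition mu" "is_partition nu" "mset mu = mset nu"
  shows "mu = nu"
proof -
  have "sort mu = rev mu" "sort nu = rev nu"
    using assms(1,2) by (auto simp: is_partition_def sorted_wrt_rev intro!: properties_for_sort)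
  moreover have "sort mu = sort nu"
    using assms(3) by (intro properties_for_sort) auto
  ultimately show ?thesis by (metis rev_is_rev_conv)
qed

lemma is_partition_remove1: "is_partition mu \<Longrightarrow> is_partition (remove1 r mu)"
  unfolding is_partition_def by (induction mu) (auto dest: set_remove1_subset[THEN subsetD])

lemma finite_partitions_of: "finite (partitions_of n)"
proof -
  have "length mu \<le> sum_list mu" if "\<forall>r\<in>set mu. 0 < r" for mu :: "nat list"
    using that by (induction mu) auto
  then have "partitions_of n \<subseteq> {mu. set mu \<subseteq> {..n} \<and> length mu \<le> n}"
    by (auto simp: partitions_of_def is_partition_def intro: member_le_sum_list)
  then show ?thesis
    by (rule finite_subset) (rule finite_lists_length_le, simp)
qed

text \<open>Injectivity holds because the multiset of parts determines a partition. Inserting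
  \<open>r\<close> gives the inverse.\<close>

lemma bij_betw_remove1_partitions:
  assumes "0 < r" "r \<le> n"
  shows "bij_betw (remove1 r) {mu \<in> partitions_of n. r \<in> set mu} (partitions_of (n - r))"
proof (rule bij_betwI')
  fix mu nu assume "mu \<in> {mu \<in> partitions_of n. r \<in> set mu}" "nu \<in> {mu \<in> partitions_of n. r \<in> set mu}"
  then have p: "is_partition mu" "is_partition nu" "r \<in> set mu" "r \<in> set nu"
    by (auto simp: partitions_of_def)
  show "(remove1 r mu = remove1 r nu) = (mu = nu)"
  proof
    assume "remove1 r mu = remove1 r nu"
    then have "mset mu - {#r#} = mset nu - {#r#}" by (metis mset_remove1)
    then have "mset mu = mset nu" using p by (metis insert_DiffM set_mset_mset)
    then show "mu = nu" using p is_partition_unique by blast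
  qed simp
next
  fix mu assume "mu \<in> {mu \<in> partitions_of n. r \<in> set mu}"
  then have "is_partition mu" "r \<in> set mu" "sum_list mu = n"
    by (auto simp: partitions_of_def)
  then show "remove1 r mu \<in> partitions_of (n - r)"
    using sum_list_map_remove1[of r mu "\<lambda>x. x"]
    by (auto simp: partitions_of_def is_partition_remove1)
next
  fix nu assume "nu \<in> partitions_of (n - r)"
  then have nu: "is_partition nu" "sum_list nu = n - r"
    by (auto simp: partitions_of_def)
  \<comment> \<open>Sorting is ascending, so the list is reversed to obtain a partition.\<close>
  define mu where "mu = rev (sort (r # nu))"
  have m: "mset mu = add_mset r (mset nu)" by (simp add: mu_def)
  have "is_partition mu"
    using nu \<open>0 < r\<close> sorted_sort_key[of "\<lambda>x. x" "r # nu"] set_sort[of "\<lambda>x. x" "r # nu"]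
    unfolding mu_def is_partition_def sorted_wrt_rev set_rev by (simp del: sort_key_simps)
  moreover have "sum_list mu = n"
    using nu(2) \<open>r \<le> n\<close> arg_cong[OF m, of sum_mset] by (simp add: sum_mset_sum_list)
  moreover have "r \<in> set mu" using arg_cong[OF m, of set_mset] by simp
  moreover have "nu = remove1 r mu"
    using m nu \<open>is_partition mu\<close> by (intro is_partition_unique is_partition_remove1) auto
  ultimately show "\<exists>mu\<in>{mu \<in> partitions_of n. r \<in> set mu}. nu = remove1 r mu"
    by (auto simp: partitions_of_def)
qed

text \<open>Terms without the part \<open>r\<close> are killed. In the others the factor
  \<open>r * count_list mu r\<close> turns \<open>1 / z_part mu\<close> into the weight of
  \<open>remove1 r mu\<close>, and removing \<open>r\<close> reindexes the sum. For
  \<open>d < r\<close> both sides are 0.\<close>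

lemma skew_hom_sym:
  assumes "0 < r"
  shows "skew (j, r) (hom_sym (avar j) d) = hom_sym (avar j) (d - int r)"
proof (cases "d < 0")
  case False
  define n where "n = nat d"
  let ?h = "\<lambda>mu. scalar (1 / of_nat (z_part mu)) * prod_list (map (avar j) mu)"
  let ?S = "{mu \<in> partitions_of n. r \<in> set mu}"
  have "skew (j, r) (hom_sym (avar j) d) = (\<Sum>mu\<in>partitions_of n. skew (j, r) (?h mu))"
    using False by (simp add: hom_sym_def n_def skew_sum)
  also have "\<dots> = (\<Sum>mu\<in>?S. skew (j, r) (?h mu))"
    by (intro sum.mono_neutral_right)
      (auto simp: finite_partitions_of skew_scalar_mult skew_power_sum count_list_0_iff
        scalar_mult scalar_def[of 0] mult.assoc[symmetric])
  also have "\<dots> = (\<Sum>mu\<in>?S. ?h (remove1 r mu))"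
  proof (intro sum.cong refl)
    fix mu assume "mu \<in> ?S"
    then have mu: "is_partition mu" "r \<in> set mu" by (auto simp: partitions_of_def)
    have "z_part (remove1 r mu) > 0" "count_list mu r \<noteq> 0"
      using mu z_part_pos is_partition_remove1 by (auto simp: count_list_0_iff)
    then show "skew (j, r) (?h mu) = ?h (remove1 r mu)"
      unfolding skew_scalar_mult skew_power_sum mult.assoc[symmetric] scalar_mult
      using z_part_remove1[OF mu(2)] assms by (simp add: field_simps)
  qed
  also have "\<dots> = hom_sym (avar j) (d - int r)"
  proof (cases "r \<le> n")
    case True
    then have "nat (d - int r) = n - r" "\<not> d - int r < 0"
      using False by (auto simp: n_def)
    then show ?thesis
      using sum.reindex_bij_betw[OF bij_betw_remove1_partitions[OF assms True], of ?h]
      by (simp add: hom_sym_def)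
  next
    case r: False
    then have S: "?S = {}"
      by (auto simp: partitions_of_def dest: member_le_sum_list)
    show ?thesis unfolding S using r False by (simp add: hom_sym_def n_def)
  qed
  finally show ?thesis .
qed (simp add: hom_sym_def)

lemma skew_hom_sym_other:
  "i \<noteq> j \<Longrightarrow> skew (j, r) (hom_sym (avar i) d) = 0"
  by (simp add: hom_sym_def skew_sum skew_scalar_mult skew_power_sum_other)

lemma hom_sym_neg [simp]: "d < 0 \<Longrightarrow> hom_sym p d = 0"
  by (simp add: hom_sym_def)

lemma hom_sym_0 [simp]: "hom_sym p 0 = 1"
proof -
  have "partitions_of 0 = {[]}"
    by (auto simp: partitions_of_def is_partition_def)
      (metis list.set_sel(1) less_irrefl)
  then show ?thesis by (simp add: hom_sym_def z_part_def scalar_def)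
qed

text \<open>The rows are given by \<open>b i = \<lambda>\<^sub>i - i\<close> instead of \<open>\<lambda>\<^sub>i\<close>, so that exchanging rows amounts to
  exchanging values of \<open>b\<close>.\<close>

definition jacobi_trudi :: "(nat \<Rightarrow> fock) \<Rightarrow> nat \<Rightarrow> (nat \<Rightarrow> int) \<Rightarrow> fock" where
  "jacobi_trudi p n b = Determinant.det (mat n n (\<lambda>(i, j). hom_sym p (b i + int j)))"

lemma jacobi_trudi_cong:
  "(\<And>i. i < n \<Longrightarrow> b i = c i) \<Longrightarrow> jacobi_trudi p n b = jacobi_trudi p n c"
  unfolding jacobi_trudi_def by (intro arg_cong[where f = Determinant.det] eq_matI) auto

lemma jacobi_trudi_expand:
  "jacobi_trudi p n b =
    (\<Sum>\<pi> | \<pi> permutes {0..<n}. signof \<pi> * (\<Prod>i = 0..<n. hom_sym p (b i + int (\<pi> i))))"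
  unfolding jacobi_trudi_def
  by (subst det_def'[of _ n])
    (auto intro!: sum.cong prod.cong arg_cong2[where f = "(*)"] simp: permutes_nat_less)

lemma skew_signof_mult: "skew v (signof \<pi> * F) = signof \<pi> * skew v F"
  using skew_sign_mult[of v 1 F] by (simp add: sign_def)

text \<open>Differentiating row \<open>i\<close> of the determinant lowers every index in that row by \<open>r\<close>.\<close>

lemma skew_jacobi_trudi:
  assumes "0 < r"
  shows "skew (j, r) (jacobi_trudi (avar j) n b) =
    (\<Sum>i<n. jacobi_trudi (avar j) n (b(i := b i - int r)))"
proof -
  let ?h = "hom_sym (avar j)"
  have "skew (j, r) (jacobi_trudi (avar j) n b) = (\<Sum>\<pi> | \<pi> permutes {0..<n}.
      signof \<pi> * (\<Sum>i = 0..<n. \<Prod>t = 0..<n.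
        if t = i then skew (j, r) (?h (b t + int (\<pi> t))) else ?h (b t + int (\<pi> t))))"
    by (simp add: jacobi_trudi_expand skew_sum skew_signof_mult skew_prod)
  also have "\<dots> = (\<Sum>\<pi> | \<pi> permutes {0..<n}. \<Sum>i = 0..<n. signof \<pi> * (\<Prod>t = 0..<n.
      ?h ((b(i := b i - int r)) t + int (\<pi> t))))"
    unfolding sum_distrib_left skew_hom_sym[OF assms]
    by (intro sum.cong refl arg_cong2[where f = "(*)"] prod.cong) (auto simp: algebra_simps)
  \<comment> \<open>Once the sums are exchanged, the inner sum for fixed \<open>i\<close> is the
    expansion of a determinant with row \<open>i\<close> altered.\<close>
  also have "\<dots> = (\<Sum>i<n. jacobi_trudi (avar j) n (b(i := b i - int r)))"
    unfolding jacobi_trudi_expand by (subst sum.swap) (simp add: lessThan_atLeast0)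
  finally show ?thesis .
qed

lemma skew_jacobi_trudi_other:
  "i \<noteq> j \<Longrightarrow> skew (j, r) (jacobi_trudi (avar i) n b) = 0"
proof -
  assume ij: "i \<noteq> j"
  have "(\<Prod>t = 0..<n. if t = x then skew (j, r) (hom_sym (avar i) (c t)) else f t) = 0"
    if "x < n" for x c f
    using that by (intro prod_zero bexI[of _ x]) (auto simp: skew_hom_sym_other[OF ij])
  then show ?thesis
    by (simp add: jacobi_trudi_expand skew_sum skew_signof_mult skew_prod)
qed

lemma jacobi_trudi_repeated:
  assumes "i < n" "t < n" "i \<noteq> t" "b i = b t"
  shows "jacobi_trudi p n b = 0"
  unfolding jacobi_trudi_def
  using assms by (intro det_identical_rows[of _ n i t]) (auto intro!: eq_vecI)

text \<open>Column indices are at most \<open>n - 1\<close>, so every index in row \<open>i\<close>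
  is negative and the row is zero.\<close>

lemma jacobi_trudi_eq_0:
  assumes "i < n" "b i \<le> - int n"
  shows "jacobi_trudi p n b = 0"
  unfolding jacobi_trudi_expand
proof (intro sum.neutral ballI)
  fix \<pi> assume "\<pi> \<in> {\<pi>. \<pi> permutes {0..<n}}"
  then have "\<pi> i < n" using assms(1) by (auto simp: permutes_nat_less)
  then have "(\<Prod>i = 0..<n. hom_sym p (b i + int (\<pi> i))) = 0"
    using assms by (intro prod_zero bexI[of _ i]) auto
  then show "signof \<pi> * (\<Prod>i = 0..<n. hom_sym p (b i + int (\<pi> i))) = 0" by simp
qed

text \<open>Row \<open>i\<close> is carried down to place \<open>t\<close> by \<open>t - i\<close>
  exchanges of adjacent rows, each costing a sign; the rows passed move up by one.\<close>

lemma jacobi_trudi_cycle: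
  assumes "i \<le> t" "t < n"
  shows "jacobi_trudi p n b = (-1) ^ (t - i) *
    jacobi_trudi p n (\<lambda>u. if i \<le> u \<and> u < t then b (Suc u) else if u = t then b i else b u)"
  using assms
proof (induction t rule: dec_induct)
  case base
  then show ?case by (auto intro: jacobi_trudi_cong)
next
  case (step t)
  let ?c = "\<lambda>t u. if i \<le> u \<and> u < t then b (Suc u) else if u = t then b i else b u"
  let ?M = "\<lambda>c. mat n n (\<lambda>(i, j). hom_sym p (c i + int j))"
  have "Determinant.det (swaprows t (Suc t) (?M (?c t))) = - Determinant.det (?M (?c t))"
    using step by (intro det_swaprows) auto
  moreover have "swaprows t (Suc t) (?M (?c t)) = ?M (?c (Suc t))"
    using step by (intro eq_matI) auto
  ultimately have "jacobi_trudi p n (?c t) = - jacobi_trudi p n (?c (Suc t))"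
    by (simp add: jacobi_trudi_def)
  then show ?case using step by (simp add: Suc_diff_le)
qed

text \<open>The last row has the entries \<open>0, ..., 0, 1\<close>, since its indices are
  \<open>j - n\<close>; the determinant is expanded along it.\<close>

lemma jacobi_trudi_Suc:
  assumes "b n = - int n"
  shows "jacobi_trudi p (Suc n) b = jacobi_trudi p n b"
proof -
  let ?M = "mat (Suc n) (Suc n) (\<lambda>(i, j). hom_sym p (b i + int j))"
  have "Determinant.det ?M = (\<Sum>j<Suc n. ?M $$ (n, j) * cofactor ?M n j)"
    by (rule laplace_expansion_row) auto
  also have "\<dots> = cofactor ?M n n"
    using assms by (simp add: sum.neutral)
  also have "\<dots> = Determinant.det (mat_delete ?M n n)"
    by (simp add: cofactor_def flip: mult_2)
  also have "mat_delete ?M n n = mat n n (\<lambda>(i, j). hom_sym p (b i + int j))"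
    by (intro eq_matI) (auto simp: mat_delete_def)
  finally show ?thesis by (simp add: jacobi_trudi_def)
qed

text \<open>A zero part in row \<open>t\<close> means \<open>b t = - t\<close>. Padding with zero
  parts thus allows partitions of different lengths to share one matrix size.\<close>

lemma jacobi_trudi_extend:
  assumes "n \<le> N" "\<And>t. n \<le> t \<Longrightarrow> b t = - int t"
  shows "jacobi_trudi p N b = jacobi_trudi p n b"
  using assms(1) by (induction N rule: dec_induct) (simp_all add: jacobi_trudi_Suc assms(2))

section \<open>Rim hooks in terms of row lengths\<close>

text \<open>Padding by zeros makes the row lengths a total function, so that partitions of different
  lengths compare pointwise.\<close>

definition part :: "nat list \<Rightarrow> nat \<Rightarrow> nat" where
  "part mu t = (if t < length mu then mu ! t else 0)"

lemma in_diagram_iff: "(t, c) \<in> diagram mu \<longleftrightarrow> c < part mu t"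
  by (simp add: diagram_def part_def)

lemma antimono_part: "is_partition mu \<Longrightarrow> antimono (part mu)"
  unfolding is_partition_def sorted_wrt_iff_nth_less
  by (auto simp: part_def monotone_def) (metis le_neq_implies_less order_refl)

lemma part_pos_iff: "is_partition mu \<Longrightarrow> 0 < part mu t \<longleftrightarrow> t < length mu"
  by (auto simp: part_def is_partition_def)

lemma partition_eqI:
  assumes "is_partition mu" "is_partition nu" "part mu = part nu"
  shows "mu = nu"
proof (rule nth_equalityI)
  have "t < length mu \<longleftrightarrow> t < length nu" for t
    using assms part_pos_iff by metis
  then show len: "length mu = length nu"
    by (metis linorder_neqE_nat order_less_irrefl)
  show "mu ! t = nu ! t" if "t < length mu" for t
    using fun_cong[OF assms(3), of t] that len by (simp add: part_def)
qed

text \<open>An antitone \<open>f\<close> stays 0 after its first zero \<open>N\<close>, so the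
  values before \<open>N\<close> are exactly the positive parts.\<close>

lemma partition_of_antimono:
  assumes "antimono f" "f n = (0::nat)"
  obtains mu where "is_partition mu" "part mu = f"
proof
  define N where "N = (LEAST t. f t = 0)"
  let ?mu = "map f [0..<N]"
  have N: "f N = 0" unfolding N_def using assms(2) by (rule LeastI)
  have pos: "0 < f t" if "t < N" for t
    using not_less_Least[of t "\<lambda>t. f t = 0"] that by (simp add: N_def)
  have "f t = 0" if "N \<le> t" for t
    using antimonoD[OF assms(1) that] N by simp
  then show "part ?mu = f" by (auto simp: part_def)
  show "is_partition ?mu"
    using pos antimonoD[OF assms(1)]
    by (auto simp: is_partition_def sorted_wrt_iff_nth_less)
qed

lemma diagram_subset_iff: "diagram mu \<subseteq> diagram lam \<longleftrightarrow> (\<forall>t. part mu t \<le> part lam t)"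
proof
  assume sub: "diagram mu \<subseteq> diagram lam"
  show "\<forall>t. part mu t \<le> part lam t"
  proof (rule allI, rule ccontr)
    fix t assume "\<not> part mu t \<le> part lam t"
    \<comment> \<open>This is the box just beyond the end of row \<open>t\<close> of
      \<open>lam\<close>.\<close>
    then have "(t, part lam t) \<in> diagram mu" by (simp add: in_diagram_iff)
    then have "(t, part lam t) \<in> diagram lam" using sub by blast
    then show False by (simp add: in_diagram_iff)
  qed
next
  assume "\<forall>t. part mu t \<le> part lam t"
  then show "diagram mu \<subseteq> diagram lam"
    by (auto simp: in_diagram_iff) (meson less_le_trans)
qed

text \<open>The skew shape with inner row lengths \<open>f\<close> and outer row lengths
  \<open>a\<close>.\<close>

definition boxes_between :: "(nat \<Rightarrow> nat) \<Rightarrow> (nat \<Rightarrow> nat) \<Rightarrow> (nat \<times> nat) set" where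
  "boxes_between f a = {(t, c). f t \<le> c \<and> c < a t}"

lemma diagram_diff: "diagram lam - diagram mu = boxes_between (part mu) (part lam)"
  by (auto simp: boxes_between_def in_diagram_iff)

text \<open>The rows of a rim hook are consecutive, and each of them ends in the column where the row
  above it begins.\<close>

definition rim_strip :: "(nat \<Rightarrow> nat) \<Rightarrow> (nat \<Rightarrow> nat) \<Rightarrow> nat \<Rightarrow> nat \<Rightarrow> bool" where
  "rim_strip f a i i' \<longleftrightarrow> i \<le> i' \<and> f i' < a i' \<and>
     (\<forall>t. i \<le> t \<and> t < i' \<longrightarrow> a (Suc t) = Suc (f t)) \<and> (\<forall>t. t < i \<or> i' < t \<longrightarrow> f t = a t)"

text \<open>Inside the strip \<open>f t < Suc (f t) = a (Suc t) <= a t\<close>; the last row is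
  nonempty by definition.\<close>

lemma rim_strip_less_iff:
  assumes "antimono a" "rim_strip f a i i'"
  shows "f t < a t \<longleftrightarrow> i \<le> t \<and> t \<le> i'"
proof (cases "i \<le> t \<and> t < i'")
  case True
  then show ?thesis
    using assms antimonoD[OF assms(1), of t "Suc t"] by (auto simp: rim_strip_def)
next
  case False
  then show ?thesis
    using assms(2) by (cases "t = i'") (auto simp: rim_strip_def)
qed

lemma rim_strip_unique:
  assumes "antimono a" "rim_strip f a i i'" "rim_strip f a j j'"
  shows "i = j" "i' = j'"
proof -
  have "i \<le> t \<and> t \<le> i' \<longleftrightarrow> j \<le> t \<and> t \<le> j'" for t
    using rim_strip_less_iff[OF assms(1)] assms(2,3) by metis
  then show "i = j" "i' = j'"
    using assms(2,3) unfolding rim_strip_def by (meson le_antisym order_refl)+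
qed

lemma rim_strip_le: "antimono a \<Longrightarrow> rim_strip f a i i' \<Longrightarrow> f t \<le> a t"
  using rim_strip_less_iff[of a f i i' t] unfolding rim_strip_def
  by (cases "t < i \<or> i' < t") auto

lemma boxes_between_strip:
  assumes "antimono a" "rim_strip f a i i'"
  shows "boxes_between f a = (SIGMA t:{i..i'}. {f t..<a t})"
  using rim_strip_less_iff[OF assms] by (fastforce simp: boxes_between_def)

lemma ht_strip:
  assumes "antimono a" "rim_strip f a i i'"
  shows "ht (boxes_between f a) = i' - i"
proof -
  have "fst ` boxes_between f a = {i..i'}"
    unfolding boxes_between_strip[OF assms]
    using rim_strip_less_iff[OF assms] by (force simp: image_iff)
  then show ?thesis
    using assms(2) by (simp add: ht_def rim_strip_def)
qed

text \<open>The row sizes telescope by \<open>a (Suc t) = Suc (f t)\<close>. In terms of length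
  minus row index, the number of boxes is the drop from the top row of \<open>a\<close> to the
  bottom row of \<open>f\<close>.\<close>

lemma card_strip:
  assumes "antimono a" "rim_strip f a i i'"
  shows "int (card (boxes_between f a)) = (int (a i) - int i) - (int (f i') - int i')"
proof -
  have tele: "(\<Sum>t=i..n. int (a t) - int (f t)) = (int (a i) - int i) - (int (f n) - int n)"
    if "i \<le> n" "n \<le> i'" for n
    using that
  proof (induction n rule: dec_induct)
    case (step n)
    then have "a (Suc n) = Suc (f n)"
      using assms(2) by (auto simp: rim_strip_def)
    then show ?case using step by simp
  qed simp
  have "card (boxes_between f a) = (\<Sum>t=i..i'. a t - f t)"
    unfolding boxes_between_strip[OF assms] by simp
  also have "int \<dots> = (\<Sum>t=i..i'. int (a t) - int (f t))"
    using rim_strip_le[OF assms] by (simp add: of_nat_diff)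
  also have "\<dots> = (int (a i) - int i) - (int (f i') - int i')"
    using assms(2) by (intro tele) (auto simp: rim_strip_def)
  finally show ?thesis .
qed

text \<open>Rows \<open>t\<close> and \<open>Suc t\<close> of the strip share exactly the column
  \<open>f t\<close>: one common column connects them and leaves no room for a square block.\<close>

lemma strip_is_rim_hook:
  assumes "antimono a" "antimono f" "rim_strip f a i i'"
  shows "is_rim_hook (boxes_between f a)"
proof -
  let ?D = "boxes_between f a"
  let ?R = "{(x, y). x \<in> ?D \<and> y \<in> ?D \<and> box_adjacent x y}"
  have less: "f t < a t \<longleftrightarrow> i \<le> t \<and> t \<le> i'" for t
    using rim_strip_less_iff[OF assms(1,3)] .
  have step: "a (Suc t) = Suc (f t)" if "i \<le> t" "t < i'" for t
    using assms(3) that by (auto simp: rim_strip_def)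
  have "(i', f i') \<in> ?D"
    using assms(3) by (auto simp: boxes_between_def rim_strip_def)
  then have "?D \<noteq> {}" by blast
  moreover have "\<nexists>r c. {(r, c), (r, Suc c), (Suc r, c), (Suc r, Suc c)} \<subseteq> ?D"
  proof
    assume "\<exists>r c. {(r, c), (r, Suc c), (Suc r, c), (Suc r, Suc c)} \<subseteq> ?D"
    then obtain r c where
      rc: "f r \<le> c" "c < a r" "f (Suc r) \<le> c" "Suc c < a (Suc r)"
      by (auto simp: boxes_between_def)
    then have "i \<le> r" "r < i'" using less[of r] less[of "Suc r"] by auto
    then show False using step rc by fastforce
  qed
  moreover have "connected_boxes ?D"
  proof -
    have sym: "(x, y) \<in> ?R\<^sup>* \<Longrightarrow> (y, x) \<in> ?R\<^sup>*" for x y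
      by (rule symD[OF sym_rtrancl]) (auto simp: sym_def box_adjacent_def)
    have row: "((t, f t), (t, c)) \<in> ?R\<^sup>*" if "f t \<le> c" "c < a t" for t c
      using that
    proof (induction c rule: dec_induct)
      case (step c)
      then have "((t, c), (t, Suc c)) \<in> ?R"
        by (auto simp: boxes_between_def box_adjacent_def)
      with step show ?case by (auto intro: rtrancl_into_rtrancl)
    qed simp
    \<comment> \<open>The path goes down from the left end of a row, then left along the next row to
      its own left end.\<close>
    have col: "((i, f i), (t, f t)) \<in> ?R\<^sup>*" if "i \<le> t" "t \<le> i'" for t
      using that
    proof (induction t rule: dec_induct)
      case (step t)
      have eq: "a (Suc t) = Suc (f t)"
        using assms(3) step by (auto simp: rim_strip_def)
      have "f t < a t" "f (Suc t) \<le> f t"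
        using less[of t] step antimonoD[OF assms(2)] by auto
      then have "((t, f t), (Suc t, f t)) \<in> ?R" "((Suc t, f (Suc t)), (Suc t, f t)) \<in> ?R\<^sup>*"
        using eq row[of "Suc t" "f t"] by (auto simp: boxes_between_def box_adjacent_def)
      then show ?case
        using step sym by (meson Suc_leD rtrancl_into_rtrancl rtrancl_trans)
    qed simp
    have "((i, f i), b) \<in> ?R\<^sup>*" if mem: "b \<in> ?D" for b
    proof -
      obtain t c where b: "b = (t, c)" "f t \<le> c" "c < a t"
        using mem by (auto simp: boxes_between_def)
      then have "i \<le> t" "t \<le> i'" using less[of t] by auto
      then show ?thesis unfolding b using col row b by (meson rtrancl_trans)
    qed
    then show ?thesis
      unfolding connected_boxes_def using sym by (meson rtrancl_trans)
  qed
  ultimately show ?thesis unfolding is_rim_hook_def by blast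
qed

text \<open>Connectedness makes consecutive rows share a column, and the absence of square blocks
  allows only one. The zero of \<open>a\<close> bounds the nonempty rows, so a first and a last one
  exist.\<close>

lemma rim_hook_imp_strip:
  assumes "antimono a" "antimono f" "\<And>t. f t \<le> a t" "a n = 0"
    and hook: "is_rim_hook (boxes_between f a)"
  obtains i i' where "rim_strip f a i i'"
proof -
  let ?D = "boxes_between f a"
  let ?R = "{(x, y). x \<in> ?D \<and> y \<in> ?D \<and> box_adjacent x y}"
  define T where "T = {t. f t < a t}"
  have "t < n" if "t \<in> T" for t
    using that antimonoD[OF assms(1), of n t] assms(4) by (force simp: T_def)
  then have fin: "finite T" by (meson finite_nat_set_iff_bounded)
  have ne: "T \<noteq> {}"
    using hook by (auto simp: is_rim_hook_def boxes_between_def T_def dest: le_less_trans)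
  have mem: "(t, f t) \<in> ?D" if "t \<in> T" for t
    using that by (simp add: boxes_between_def T_def)
  define i i' where "i = Min T" and "i' = Max T"
  have T: "i \<in> T" "i' \<in> T" using fin ne by (auto simp: i_def i'_def)
  have conn: "((i, f i), (i', f i')) \<in> ?R\<^sup>*"
    using hook mem T unfolding is_rim_hook_def connected_boxes_def by blast
  have step: "a (Suc t) = Suc (f t)" if t: "i \<le> t" "t < i'" for t
  proof -
    \<comment> \<open>Otherwise no box in row \<open>t\<close> is adjacent to one in the next row, and the hook falls apart.\<close>
    have "f t < a (Suc t)"
    proof (rule ccontr)
      assume cut: "\<not> f t < a (Suc t)"
      \<comment> \<open>A path leaving the rows up to \<open>t\<close> must step down within one
        column \<open>c\<close>, which would give \<open>f t <= c < a (Suc t)\<close>.\<close>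
      have "fst y \<le> t" if "(x, y) \<in> ?R\<^sup>*" "fst x \<le> t" for x y
        using that
      proof (induction rule: rtrancl_induct)
        case (step y z)
        have "fst y \<le> t" "y \<in> ?D" "z \<in> ?D" "box_adjacent y z" using step by auto
        show ?case
        proof (rule ccontr)
          assume "\<not> fst z \<le> t"
          then have "fst y = t" "fst z = Suc t" "snd y = snd z"
            using \<open>fst y \<le> t\<close> \<open>box_adjacent y z\<close> by (auto simp: box_adjacent_def)
          then show False
            using \<open>y \<in> ?D\<close> \<open>z \<in> ?D\<close> cut by (auto simp: boxes_between_def)
        qed
      qed
      then show False using conn t by fastforce
    qed
    moreover have "\<not> Suc (f t) < a (Suc t)"
    proof
      assume wide: "Suc (f t) < a (Suc t)"
      have "f (Suc t) \<le> f t" "a (Suc t) \<le> a t"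
        using assms(1,2) by (auto intro: antimonoD)
      with wide have "{(t, f t), (t, Suc (f t)), (Suc t, f t), (Suc t, Suc (f t))} \<subseteq> ?D"
        by (auto simp: boxes_between_def)
      then show False using hook unfolding is_rim_hook_def by blast
    qed
    ultimately show ?thesis by simp
  qed
  have "f t = a t" if "t < i \<or> i' < t" for t
  proof -
    have "t \<notin> T" using that fin by (auto simp: i_def i'_def dest: Min_le Max_ge)
    then show ?thesis using assms(3)[of t] by (simp add: T_def)
  qed
  moreover have "i \<le> i'" using T fin by (simp add: i_def)
  ultimately have "rim_strip f a i i'"
    using T step by (auto simp: rim_strip_def T_def)
  then show ?thesis by (rule that)
qed

section \<open>The Murnaghan-Nakayama rule\<close>

text \<open>The beta numbers of a partition up to a common shift; they continue as
  \<open>- t\<close> beyond the last part.\<close>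

definition beta :: "nat list \<Rightarrow> nat \<Rightarrow> int" where
  "beta mu t = int (part mu t) - int t"

lemma beta_less: "is_partition mu \<Longrightarrow> t < u \<Longrightarrow> beta mu u < beta mu t"
  using antimonoD[OF antimono_part, of mu t u] by (simp add: beta_def)

lemma schur_eq_jacobi_trudi:
  assumes "length mu \<le> n"
  shows "schur p mu = jacobi_trudi p n (beta mu)"
proof -
  have "schur p mu = jacobi_trudi p (length mu) (beta mu)"
    unfolding schur_def jacobi_trudi_def
    by (intro arg_cong[where f = Determinant.det] eq_matI) (auto simp: beta_def part_def)
  then show ?thesis
    using assms by (simp add: jacobi_trudi_extend beta_def part_def)
qed

text \<open>The lowered value lies strictly between two consecutive beta numbers of
  \<open>lam\<close>. Hence the top row \<open>i\<close> and the size \<open>r\<close> determine the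
  bottom row \<open>i'\<close>.\<close>

lemma beta_strip:
  assumes "is_partition lam" "is_partition mu" "rim_strip (part mu) (part lam) i i'"
    and "card (diagram lam - diagram mu) = r"
  shows "beta mu i' = beta lam i - int r" "beta mu i' < beta lam i'" "beta lam (Suc i') < beta mu i'"
    and "i' < length lam"
proof -
  show "beta mu i' = beta lam i - int r"
    using card_strip[OF antimono_part[OF assms(1)] assms(3)] assms(4)
    by (simp add: diagram_diff beta_def)
  have less: "part mu i' < part lam i'" using assms(3) by (simp add: rim_strip_def)
  then show "beta mu i' < beta lam i'" by (simp add: beta_def)
  have "beta lam (Suc i') = beta mu (Suc i')"
    using assms(3) by (simp add: beta_def rim_strip_def)
  then show "beta lam (Suc i') < beta mu i'"
    using beta_less[OF assms(2)] by simp
  show "i' < length lam"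
    using less part_pos_iff[OF assms(1), of i'] by linarith
qed

text \<open>Moving the lowered row from \<open>i\<close> to \<open>i'\<close> restores decreasing
  order and produces the beta numbers of \<open>mu\<close>; the number of exchanges is the
  height.\<close>

lemma jacobi_trudi_strip:
  assumes "is_partition lam" "is_partition mu" "rim_strip (part mu) (part lam) i i'"
    and "card (diagram lam - diagram mu) = r"
  shows "jacobi_trudi p (length lam) ((beta lam)(i := beta lam i - int r)) =
    (-1) ^ ht (diagram lam - diagram mu) * schur p mu"
proof -
  let ?b = "(beta lam)(i := beta lam i - int r)"
  let ?c = "\<lambda>u. if i \<le> u \<and> u < i' then ?b (Suc u) else if u = i' then ?b i else ?b u"
  note a = antimono_part[OF assms(1)]
  have "i \<le> i'" using assms(3) by (simp add: rim_strip_def)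
  \<comment> \<open>For \<open>i <= u < i'\<close> the strip condition says
    \<open>beta lam (Suc u) = beta mu u\<close>.\<close>
  have c: "?c u = beta mu u" for u
    using assms(3) beta_strip(1)[OF assms] by (auto simp: rim_strip_def beta_def)
  have "t < length lam" if "t < length mu" for t
    using part_pos_iff[OF assms(1), of t] part_pos_iff[OF assms(2), of t]
      rim_strip_le[OF a assms(3), of t] that by linarith
  then have len: "length mu \<le> length lam" by (meson leI less_irrefl)
  have "jacobi_trudi p (length lam) ?b = (-1) ^ (i' - i) * jacobi_trudi p (length lam) ?c"
    using \<open>i \<le> i'\<close> beta_strip(4)[OF assms] by (rule jacobi_trudi_cycle)
  also have "\<dots> = (-1) ^ ht (diagram lam - diagram mu) * schur p mu"
    unfolding c diagram_diff ht_strip[OF a assms(3)] schur_eq_jacobi_trudi[OF len] ..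
  finally show ?thesis .
qed

text \<open>A lowered value that is neither too small nor already present falls into a gap between
  beta numbers, and from it a partition contradicting \<open>no\<close> is built.\<close>

lemma jacobi_trudi_no_strip:
  assumes "is_partition lam" "0 < r" "i < length lam"
    and no: "\<And>mu i'. is_partition mu \<Longrightarrow> rim_strip (part mu) (part lam) i i' \<Longrightarrow>
      card (diagram lam - diagram mu) \<noteq> r"
  shows "jacobi_trudi p (length lam) ((beta lam)(i := beta lam i - int r)) = 0"
proof (cases "beta lam i - int r \<le> - int (length lam)")
  case True
  then show ?thesis using assms(3) by (intro jacobi_trudi_eq_0[of i]) auto
next
  case False
  define l where "l = length lam"
  define v where "v = beta lam i - int r"
  have bl: "beta lam l = - int l" by (simp add: beta_def part_def l_def)
  \<comment> \<open>The first index whose beta number does not exceed \<open>v\<close>; index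
    \<open>l\<close> qualifies because \<open>- l < v\<close>.\<close>
  define t where "t = (LEAST t. beta lam t \<le> v)"
  have le: "beta lam t \<le> v"
    unfolding t_def using False bl by (intro LeastI[of "\<lambda>t. beta lam t \<le> v" l]) (simp add: v_def l_def)
  have "t \<le> l"
    unfolding t_def using False bl by (intro Least_le) (simp add: v_def l_def)
  have before: "v < beta lam u" if "u < t" for u
    using not_less_Least[of u "\<lambda>t. beta lam t \<le> v"] that by (simp add: t_def)
  have "i < t"
  proof (rule ccontr)
    assume "\<not> i < t"
    then have "beta lam i \<le> beta lam t"
      using beta_less[OF assms(1), of t i] by (cases "t = i") auto
    then show False using le assms(2) by (simp add: v_def)
  qed
  show ?thesis
  proof (cases "beta lam t = v")
    case True
    then have "t \<noteq> l" using bl False by (auto simp: v_def l_def)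
    then have "t < length lam" using \<open>t \<le> l\<close> by (simp add: l_def)
    then show ?thesis
      using \<open>i < t\<close> assms(3) True by (intro jacobi_trudi_repeated[of i _ t]) (auto simp: v_def)
  next
    case neq: False
    define i' where "i' = t - 1"
    have i': "t = Suc i'" "i \<le> i'" "i' < l" using \<open>i < t\<close> \<open>t \<le> l\<close> by (auto simp: i'_def)
    \<comment> \<open>Each row from \<open>i\<close> to \<open>i' - 1\<close> takes the length of
      the next row less one box, and row \<open>i'\<close> gets the length with beta number
      \<open>v\<close>. By \<open>beta lam (Suc i') < v\<close> that length is nonnegative, so
      \<open>nat\<close> truncates nothing.\<close>
    define f where "f u = (if i \<le> u \<and> u < i' then part lam (Suc u) - 1
      else if u = i' then nat (v + int i') else part lam u)" for u
    note a = antimonoD[OF antimono_part[OF assms(1)]]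
    have v: "beta lam t < v" "v < beta lam i'" using le neq before[of i'] i' by auto
    have fi': "int (f i') = v + int i'"
      using v(1) by (simp add: f_def i' beta_def)
    have pos: "0 < part lam u" if "u \<le> i'" for u
      using part_pos_iff[OF assms(1), of u] that i' by (simp add: l_def)
    have "f (Suc u) \<le> f u" for u
    proof -
      have 1: "part lam (Suc u) \<le> part lam u" "part lam (Suc (Suc u)) \<le> part lam (Suc u)"
        by (auto intro: a)
      \<comment> \<open>The comparisons of row \<open>i'\<close> with its neighbors are the cases
        that use the bounds on \<open>v\<close>.\<close>
      consider "Suc u < i" | "Suc u = i" "i < i'" | "Suc u = i" "i = i'" | "i \<le> u" "Suc u < i'"
        | "i \<le> u" "Suc u = i'" | "u = i'" | "i' < u" using i' by linarith
      then show ?thesis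
      proof cases
        case 3
        then show ?thesis using fi' v 1 i' by (auto simp: f_def beta_def)
      next
        case 5
        then show ?thesis using fi' v 1 pos[of i'] by (auto simp: f_def beta_def)
      next
        case 6
        then show ?thesis using fi' v 1 i' by (auto simp: f_def beta_def)
      qed (use 1 i' in \<open>auto simp: f_def\<close>)
    qed
    then have "antimono f" by (simp add: antimono_iff_le_Suc)
    moreover have "f l = 0" using i' by (simp add: f_def l_def part_def)
    ultimately obtain mu where mu: "is_partition mu" "part mu = f"
      by (rule partition_of_antimono)
    have strip: "rim_strip (part mu) (part lam) i i'"
      unfolding mu rim_strip_def using i' v fi' pos
      by (auto simp: f_def beta_def Suc_le_eq)
    then have "beta mu i' = beta lam i - int (card (diagram lam - diagram mu))"
      using beta_strip(1)[OF assms(1) mu(1)] by blast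
    moreover have "beta mu i' = v" using fi' by (simp add: beta_def mu)
    ultimately show ?thesis using no[OF mu(1) strip] by (simp add: v_def)
  qed
qed

section \<open>Removing hooks from a single partition\<close>

definition hook_removals :: "nat \<Rightarrow> nat list \<Rightarrow> nat list set" where
  "hook_removals r lam = {mu. is_partition mu \<and> diagram mu \<subseteq> diagram lam \<and>
     is_rim_hook (diagram lam - diagram mu) \<and> card (diagram lam - diagram mu) = r}"

lemma hook_removals_iff:
  assumes "is_partition lam"
  shows "mu \<in> hook_removals r lam \<longleftrightarrow> is_partition mu \<and>
    (\<exists>i i'. rim_strip (part mu) (part lam) i i') \<and> card (diagram lam - diagram mu) = r"
    (is "?L \<longleftrightarrow> ?R")
proof
  note a = antimono_part[OF assms]
  have z: "part lam (length lam) = 0" by (simp add: part_def)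
  assume ?L
  then show ?R
    using rim_hook_imp_strip[OF a antimono_part[of mu] _ z]
    by (simp add: hook_removals_def diagram_subset_iff diagram_diff) metis
next
  note a = antimono_part[OF assms]
  assume ?R
  then show ?L
    using strip_is_rim_hook[OF a antimono_part[of mu]] rim_strip_le[OF a]
    by (auto simp: hook_removals_def diagram_subset_iff diagram_diff)
qed

text \<open>Each hook is matched with its top row. This is injective, rows that are no top row
  contribute 0, and the remaining determinants are signed Schur functions.\<close>

lemma skew_schur:
  assumes "is_partition lam" "0 < r"
  shows "skew (j, r) (schur (avar j) lam) = (\<Sum>mu\<in>hook_removals r lam.
    (-1) ^ ht (diagram lam - diagram mu) * schur (avar j) mu)"
proof -
  let ?H = "hook_removals r lam"
  let ?l = "length lam"
  let ?J = "\<lambda>i. jacobi_trudi (avar j) ?l ((beta lam)(i := beta lam i - int r))"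
  define top where "top mu = (SOME i. \<exists>i'. rim_strip (part mu) (part lam) i i')" for mu
  have top: "\<exists>i'. rim_strip (part mu) (part lam) (top mu) i'" if "mu \<in> ?H" for mu
    using that unfolding top_def hook_removals_iff[OF assms(1)] by (metis (mono_tags, lifting) someI)
  have H: "is_partition mu" "card (diagram lam - diagram mu) = r" if "mu \<in> ?H" for mu
    using that by (auto simp: hook_removals_def)
  have inj: "inj_on top ?H"
  proof (rule inj_onI)
    fix mu nu assume mn: "mu \<in> ?H" "nu \<in> ?H" "top mu = top nu"
    define i where "i = top mu"
    obtain i' j' where s: "rim_strip (part mu) (part lam) i i'" "rim_strip (part nu) (part lam) i j'"
      using top[OF mn(1)] top[OF mn(2)] mn(3) by (auto simp: i_def)
    note bm = beta_strip[OF assms(1) H(1)[OF mn(1)] s(1) H(2)[OF mn(1)]]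
    note bn = beta_strip[OF assms(1) H(1)[OF mn(2)] s(2) H(2)[OF mn(2)]]
    \<comment> \<open>Both strips insert the same value \<open>beta lam i - r\<close>, and the gaps
      below different beta numbers are disjoint.\<close>
    have "\<not> Suc i' \<le> j'" "\<not> Suc j' \<le> i'"
      using bm bn beta_less[OF assms(1), of "Suc i'" j'] beta_less[OF assms(1), of "Suc j'" i']
      by (auto simp: le_less)
    then have "i' = j'" by simp
    have "part mu t = part nu t" for t
    proof (cases "t = i'")
      case True
      then show ?thesis using bm(1) bn(1) \<open>i' = j'\<close> by (simp add: beta_def)
    next
      case False
      then show ?thesis
        using s \<open>i' = j'\<close> unfolding rim_strip_def by (metis Suc_inject linorder_neqE_nat not_le)
    qed
    then show "mu = nu" using H(1) mn(1,2) by (intro partition_eqI) auto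
  qed
  have sub: "top ` ?H \<subseteq> {..<?l}"
  proof
    fix i assume "i \<in> top ` ?H"
    then obtain mu where "mu \<in> ?H" "i = top mu" by blast
    moreover from this obtain i' where "rim_strip (part mu) (part lam) i i'" using top by blast
    ultimately have "i \<le> i'" "i' < ?l"
      using beta_strip(4)[OF assms(1) H(1) _ H(2)] by (auto simp: rim_strip_def)
    then show "i \<in> {..<?l}" by simp
  qed
  have zero: "?J i = 0" if "i \<in> {..<?l} - top ` ?H" for i
  proof (rule jacobi_trudi_no_strip)
    show "card (diagram lam - diagram mu) \<noteq> r"
      if mu: "is_partition mu" "rim_strip (part mu) (part lam) i i'" for mu i'
    proof
      assume "card (diagram lam - diagram mu) = r"
      then have "mu \<in> ?H" using mu hook_removals_iff[OF assms(1)] by blast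
      moreover from this have "top mu = i"
        using top rim_strip_unique(1)[OF antimono_part[OF assms(1)] _ mu(2)] by blast
      ultimately show False using \<open>i \<in> {..<?l} - top ` ?H\<close> by blast
    qed
  qed (use assms that in auto)
  have "skew (j, r) (schur (avar j) lam) = (\<Sum>i<?l. ?J i)"
    using schur_eq_jacobi_trudi[of lam ?l] skew_jacobi_trudi[OF assms(2)] by simp
  also have "\<dots> = (\<Sum>i\<in>top ` ?H. ?J i)"
    using sub zero by (intro sum.mono_neutral_right) auto
  also have "\<dots> = (\<Sum>mu\<in>?H. ?J (top mu))"
    using inj by (simp add: sum.reindex)
  also have "\<dots> = (\<Sum>mu\<in>?H. (-1) ^ ht (diagram lam - diagram mu) * schur (avar j) mu)"
  proof (intro sum.cong refl)
    fix mu assume "mu \<in> ?H"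
    then show "?J (top mu) = (-1) ^ ht (diagram lam - diagram mu) * schur (avar j) mu"
      using top[of mu] H[of mu] jacobi_trudi_strip[OF assms(1)] by blast
  qed
  finally show ?thesis .
qed

lemma skew_schur_other: "i \<noteq> j \<Longrightarrow> skew (j, r) (schur (avar i) lam) = 0"
  by (simp add: schur_eq_jacobi_trudi[OF order_refl] skew_jacobi_trudi_other)

section \<open>Colored partitions and the character formula\<close>

lemma rim_hook_removals_eq:
  assumes "j < length L"
  shows "rim_hook_removals r L j = (\<lambda>mu. L[j := mu]) ` hook_removals r (L ! j)"
proof (intro equalityI subsetI)
  fix M assume M: "M \<in> rim_hook_removals r L j"
  then have "M = L[j := M ! j]"
    using assms by - (rule nth_equalityI, auto simp: rim_hook_removals_def nth_list_update)
  then show "M \<in> (\<lambda>mu. L[j := mu]) ` hook_removals r (L ! j)"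
    using M by (auto simp: rim_hook_removals_def hook_removals_def colored_diff_def)
qed (use assms in \<open>auto simp: rim_hook_removals_def hook_removals_def colored_diff_def\<close>)

lemma colored_schur_split:
  assumes "j < length L"
  shows "colored_schur L = schur (avar j) (L ! j) * (\<Prod>i\<in>{..<length L} - {j}. schur (avar i) (L ! i))"
  unfolding colored_schur_def using assms by (intro prod.remove) auto

text \<open>The factors of the other colors involve none of the variables of color \<open>j\<close>,
  so they act as constants in the Leibniz rule.\<close>

lemma skew_colored_schur:
  assumes "j < length L" "is_partition (L ! j)" "0 < r"
  shows "skew (j, r) (colored_schur L) =
    (\<Sum>M\<in>rim_hook_removals r L j. (-1) ^ ht (colored_diff L M j) * colored_schur M)"
proof -
  let ?rest = "\<Prod>i\<in>{..<length L} - {j}. schur (avar i) (L ! i)"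
  have "skew (j, r) ?rest = 0"
    by (subst skew_prod) (auto intro!: sum.neutral prod_zero simp: skew_schur_other)
  then have "skew (j, r) (colored_schur L) = skew (j, r) (schur (avar j) (L ! j)) * ?rest"
    by (simp add: colored_schur_split[OF assms(1)] skew_mult)
  also have "\<dots> = (\<Sum>mu\<in>hook_removals r (L ! j).
      (-1) ^ ht (colored_diff L (L[j := mu]) j) * colored_schur (L[j := mu]))"
    unfolding skew_schur[OF assms(2,3)] sum_distrib_right
  proof (intro sum.cong refl)
    fix mu
    have "colored_schur (L[j := mu]) = schur (avar j) mu * ?rest"
      using assms(1) by (subst colored_schur_split[of j]) (auto intro!: prod.cong arg_cong2[where f = "(*)"])
    then show "(-1) ^ ht (diagram (L ! j) - diagram mu) * schur (avar j) mu * ?rest =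
        (-1) ^ ht (colored_diff L (L[j := mu]) j) * colored_schur (L[j := mu])"
      using assms(1) by (simp add: colored_diff_def mult.assoc)
  qed
  also have "\<dots> = (\<Sum>M\<in>rim_hook_removals r L j. (-1) ^ ht (colored_diff L M j) * colored_schur M)"
    unfolding rim_hook_removals_eq[OF assms(1)]
    by (subst sum.reindex) (use assms(1) in \<open>auto intro!: inj_onI dest: arg_cong[where f = "\<lambda>M. M ! j"]\<close>)
  finally show ?thesis .
qed

lemma prod_list_delete_nth:
  fixes f :: "'a \<Rightarrow> 'b::comm_monoid_mult"
  assumes "m < length xs"
  shows "prod_list (map f xs) = f (xs ! m) * prod_list (map f (delete_nth m xs))"
proof -
  have "prod_list (map f xs) = prod_list (map f (take m xs @ xs ! m # drop (Suc m) xs))"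
    using id_take_nth_drop[OF assms] by simp
  then show ?thesis by (simp add: delete_nth_def ac_simps)
qed

lemma power_tilde_remove_part:
  assumes "s < k" "s < length R" "m < length (R ! s)"
  shows "power_tilde k R = avar_tilde k s (R ! s ! m) * power_tilde k (remove_part R s m)"
proof -
  let ?f = "\<lambda>R i. prod_list (map (avar_tilde k i) (R ! i))"
  have split: "power_tilde k R = ?f R s * (\<Prod>i\<in>{..<k} - {s}. ?f R i)" for R
    unfolding power_tilde_def using assms(1) by (intro prod.remove) auto
  have "(\<Prod>i\<in>{..<k} - {s}. ?f (remove_part R s m) i) = (\<Prod>i\<in>{..<k} - {s}. ?f R i)"
    by (intro prod.cong) (auto simp: remove_part_def)
  moreover have "?f R s = avar_tilde k s (R ! s ! m) * ?f (remove_part R s m) s"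
    using prod_list_delete_nth[OF assms(3)] assms(2) by (simp add: remove_part_def)
  ultimately show ?thesis
    by (simp only: split[of R] split[of "remove_part R s m"] mult.assoc)
qed

theorem theorem1p1:
  fixes k n s m :: nat and lam rho :: "nat list list"
  assumes "k \<ge> 1" and "n \<ge> 1"
    and "is_colored_partition k n lam" and "is_colored_partition k n rho"
    and "s < k" and "m < length (rho ! s)"
  shows "wreath_char k lam rho =
    (\<Sum>j<k. \<Sum>mu\<in>rim_hook_removals (rho ! s ! m) lam j.
       (-1) ^ ht (colored_diff lam mu j) * omega k powi (- int (s * j)) *
       wreath_char k mu (remove_part rho s m))"
proof -
  let ?r = "rho ! s ! m"
  let ?P = "power_tilde k (remove_part rho s m)"
  have lam: "length lam = k" "\<And>j. j < k \<Longrightarrow> is_partition (lam ! j)"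
    using assms(3) by (auto simp: is_colored_partition_def)
  have rho: "length rho = k" "is_partition (rho ! s)"
    using assms(4,5) by (auto simp: is_colored_partition_def)
  then have "0 < ?r" using assms(6) by (simp add: is_partition_def)
  have "wreath_char k lam rho = form (colored_schur lam)
      (\<Sum>j<k. scalar (omega k powi (- int (s * j))) * (avar j ?r * ?P))"
    using power_tilde_remove_part[of s k rho m] rho assms(5,6)
    by (simp add: wreath_char_def avar_tilde_def sum_distrib_right mult.assoc)
  also have "\<dots> = (\<Sum>j<k. omega k powi (- int (s * j)) *
      form (skew (j, ?r) (colored_schur lam)) ?P)"
    by (simp only: form_sum_right form_scalar_right form_avar_mult)
  also have "\<dots> = (\<Sum>j<k. \<Sum>mu\<in>rim_hook_removals ?r lam j.
       (-1) ^ ht (colored_diff lam mu j) * omega k powi (- int (s * j)) *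
       wreath_char k mu (remove_part rho s m))"
  proof (intro sum.cong refl)
    fix j assume "j \<in> {..<k}"
    \<comment> \<open>The sign is written as a \<open>scalar\<close> so that it can be pulled out of
      the form.\<close>
    then have "skew (j, ?r) (colored_schur lam) = (\<Sum>mu\<in>rim_hook_removals ?r lam j.
        scalar ((-1) ^ ht (colored_diff lam mu j)) * colored_schur mu)"
      using skew_colored_schur[of j lam ?r] lam \<open>0 < ?r\<close> by (simp add: scalar_sign)
    then show "omega k powi (- int (s * j)) * form (skew (j, ?r) (colored_schur lam)) ?P =
        (\<Sum>mu\<in>rim_hook_removals ?r lam j.
          (-1) ^ ht (colored_diff lam mu j) * omega k powi (- int (s * j)) *
          wreath_char k mu (remove_part rho s m))"
      by (simp add: form_sum_left form_scalar_left sum_distrib_left wreath_char_def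
          mult.assoc mult.left_commute)
  qed
  finally show ?thesis .
qed

end
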